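(* Fix $\epsilon>0$ and a polynomial $f\in\mathbb{Z}[x]$ of degree $d\ge 3$. For any sequence of complex weights $(a_n)_{n=1}^\infty$, any integer $M\ge 0$, and any positive integers $Q,N$ with $Q^d\le N\le Q^{2d}$, we have $$\sum_{q=1}^{Q}\ \sum_{\substack{a=1\\ \gcd(a,f(q))=1}}^{f(q)}\bigg|\sum_{n=M+1}^{M+N}a_n\exp\bigg(\frac{2\pi i a n}{f(q)}\bigg)\bigg|^2\ll_{f,\epsilon}\Big(NQ^{1/2}+N^{3/4}Q^{d/2+2-1/(50d)}\Big)Q^{\epsilon}\sum_{n=M+1}^{M+N}|a_n|^2,$$ where the implied constant depends only on $f$ and $\epsilon$.
   Context: In the sum over $a$, $a$ is an integer variable (not to be confused with the weights $a_n$); a sum over $1\le a\le f(q)$ is empty if $f(q)\le 0$. *)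

theory Defs
  imports "HOL-Analysis.Analysis" "HOL-Computational_Algebra.Polynomial"
begin

end

theory Submission
  imports Defs
begin

text \<open>
  In the range \<open>Q\<^sup>d \<le> N \<le> Q\<^sup>2\<^sup>d\<close> the elementary large sieve, applied to each modulus on its own,
  already gives the bound. For a fixed modulus \<open>m\<close>, orthogonality of the additive characters shows
  that the sum over \<^emph>\<open>all\<close> residues \<open>b\<close> modulo \<open>m\<close> counts pairs \<open>n \<equiv> k (mod m)\<close> weighted by
  \<open>a\<^sub>n\<close> and the conjugate of \<open>a\<^sub>k\<close>; since an interval of length \<open>N\<close> meets a residue class in at most
  \<open>N / m + 1\<close> points, the sum is at most \<open>(N + m) \<Sum> \<bar>a\<^sub>n\<bar>\<^sup>2\<close>
  (\<open>additive_large_sieve_single_modulus\<close>). Dropping the condition \<open>gcd(b, f(q)) = 1\<close> only enlarges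
  the left-hand side.

  Now \<open>f(q) \<le> B q\<^sup>d \<le> B Q\<^sup>d \<le> B N\<close>, where \<open>B\<close> is the sum of the absolute values of the
  coefficients, so summing over \<open>q \<le> Q\<close> gives at most \<open>(1 + B) Q N \<Sum> \<bar>a\<^sub>n\<bar>\<^sup>2\<close>. Finally \<open>N \<le> Q\<^sup>2\<^sup>d\<close>
  means \<open>N\<^sup>1\<^sup>/\<^sup>4 \<le> Q\<^sup>d\<^sup>/\<^sup>2\<close>, hence \<open>Q N \<le> N\<^sup>3\<^sup>/\<^sup>4 Q\<^sup>d\<^sup>/\<^sup>2\<^sup>+\<^sup>1\<close>, and the second term of the claimed bound has a
  larger power of \<open>Q\<close> because \<open>2 - 1/(50 d) \<ge> 1\<close>.
\<close>

lemma sum_powers_root_of_unity: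
  fixes z :: complex
  assumes "z ^ m = 1"
  shows "(\<Sum>b=1..m. z ^ b) = (if z = 1 then of_nat m else 0)"
proof -
  have "(\<Sum>b=1..m. z ^ b) = z * (\<Sum>b<m. z ^ b)"
    by (simp add: sum_distrib_left sum.atLeast1_atMost_eq)
  then show ?thesis
    using assms by (auto simp: geometric_sum)
qed

lemma sum_additive_characters:
  fixes m n k :: nat
  assumes "m > 0"
  defines "e \<equiv> \<lambda>n::nat. exp (2 * of_real pi * \<i> * of_nat n / of_nat m)"
  shows "(\<Sum>b=1..m. e n ^ b * cnj (e k ^ b)) = (if n mod m = k mod m then of_nat m else 0)"
proof -
  have "cmod (e k) = 1"
    by (simp add: e_def norm_exp_eq_Re)
  then have norm_e: "e k * cnj (e k) = 1"
    using complex_norm_square[of "e k"] by simp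
  then have "cnj (e k) = inverse (e k)" and "e k \<noteq> 0"
    by (auto intro: inverse_unique [symmetric])
  then have "e n * cnj (e k) = 1 \<longleftrightarrow> e n = e k"
    by (simp only: divide_inverse [symmetric] right_inverse_eq not_False_eq_True)
  also have "\<dots> \<longleftrightarrow> n mod m = k mod m"
    unfolding e_def using assms by (intro complex_root_unity_eq) simp
  finally have eq: "e n * cnj (e k) = 1 \<longleftrightarrow> n mod m = k mod m" .
  have pow_e: "e j ^ m = 1" for j
    unfolding e_def using assms by (intro complex_root_unity) simp
  have "(e n * cnj (e k)) ^ m = e n ^ m * cnj (e k ^ m)"
    by (simp only: power_mult_distrib complex_cnj_power)
  then have "(e n * cnj (e k)) ^ m = 1"
    by (simp only: pow_e complex_cnj_one mult_1)
  from sum_powers_root_of_unity[OF this] show ?thesis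
    by (simp add: eq power_mult_distrib)
qed

lemma card_residue_class_interval:
  fixes m M N r :: nat
  assumes "m > 0"
  shows "m * card {k \<in> {M+1..M+N}. k mod m = r} \<le> N + m"
proof -
  let ?A = "{k \<in> {M+1..M+N}. k mod m = r}"
  \<comment> \<open>Shifting the interval to start at \<open>0\<close> before dividing keeps the bound independent of \<open>M\<close>.\<close>
  let ?g = "\<lambda>k. (k - (M+1)) div m"
  have inj: "x = y" if "x \<in> ?A" "y \<in> ?A" and eq: "?g x = ?g y" and "x \<le> y" for x y
  proof -
    have lower: "M + 1 \<le> x" and "y mod m = x mod m"
      using that(1,2) by auto
    from this(2) \<open>x \<le> y\<close> obtain c where c: "y = x + m * c"
      by (rule mod_eq_nat1E)
    have shift: "y - (M+1) = (x - (M+1)) + m * c"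
      unfolding c using lower by (rule diff_add_assoc2)
    have "?g y = c + ?g x"
      unfolding shift using assms by (intro div_mult_self2) simp
    with eq have "c = 0" by linarith
    with c show "x = y" by simp
  qed
  have "inj_on ?g ?A"
  proof (rule inj_onI)
    fix x y assume "x \<in> ?A" "y \<in> ?A" "?g x = ?g y"
    then show "x = y"
      using inj[of x y] inj[of y x] by (metis linorder_le_cases)
  qed
  moreover have "?g ` ?A \<subseteq> {..N div m}"
  proof (rule image_subsetI)
    fix k assume "k \<in> ?A"
    then have "k - (M+1) \<le> N" by auto
    then show "?g k \<in> {..N div m}"
      unfolding atMost_iff by (rule div_le_mono)
  qed
  ultimately have "card ?A \<le> card {..N div m}"
    by (rule card_inj_on_le) (rule finite_atMost)
  then have "m * card ?A \<le> m * (N div m + 1)"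
    by (intro mult_le_mono2) (simp only: card_atMost Suc_eq_plus1)
  also have "\<dots> = m * (N div m) + m"
    by (simp only: distrib_left mult_1_right)
  also have "\<dots> \<le> N + m"
    by (intro add_right_mono times_div_less_eq_dividend)
  finally show ?thesis .
qed

text \<open>
  Once orthogonality has removed the characters, the off-diagonal products are controlled by
  \<open>\<bar>a\<^sub>n a\<^sub>k\<bar> \<le> (\<bar>a\<^sub>n\<bar>\<^sup>2 + \<bar>a\<^sub>k\<bar>\<^sup>2) / 2\<close>; by symmetry of the congruence both halves contribute the same,
  and each \<open>\<bar>a\<^sub>n\<bar>\<^sup>2\<close> is counted once for every \<open>k\<close> in the residue class of \<open>n\<close>.
\<close>
lemma additive_large_sieve_single_modulus:
  fixes a :: "nat \<Rightarrow> complex" and m M N :: nat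
  assumes "m > 0"
  shows "(\<Sum>b=1..m. (cmod (\<Sum>n=M+1..M+N. a n *
            exp (2 * of_real pi * \<i> * of_nat b * of_nat n / of_nat m)))\<^sup>2)
         \<le> (real N + real m) * (\<Sum>n=M+1..M+N. (cmod (a n))\<^sup>2)"
proof -
  let ?I = "{M+1..M+N}"
  define e where "e \<equiv> \<lambda>n::nat. exp (2 * of_real pi * \<i> * of_nat n / of_nat m)"
  define \<delta> :: "nat \<Rightarrow> nat \<Rightarrow> real"
    where "\<delta> \<equiv> \<lambda>n k. if n mod m = k mod m then real m else 0"
  have exp_eq: "exp (2 * of_real pi * \<i> * of_nat b * of_nat n / of_nat m) = e n ^ b" for b n :: nat
    by (simp add: e_def mult_ac flip: exp_of_nat_mult)
  have orth: "(\<Sum>b=1..m. e n ^ b * cnj (e k ^ b)) = of_real (\<delta> n k)" for n k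
    using sum_additive_characters[OF assms, of n k] by (simp add: e_def \<delta>_def)
  have sym: "\<delta> n k = \<delta> k n" for n k
    by (simp add: \<delta>_def)
  have nonneg: "\<delta> n k \<ge> 0" for n k
    by (simp add: \<delta>_def)
  have row: "(\<Sum>k\<in>?I. \<delta> n k) \<le> real N + real m" for n
  proof -
    have "(\<Sum>k\<in>?I. \<delta> n k) = (\<Sum>k \<in> {k \<in> ?I. k mod m = n mod m}. real m)"
      by (subst sum.inter_filter) (auto simp: \<delta>_def intro!: sum.cong)
    also have "\<dots> = real (m * card {k \<in> ?I. k mod m = n mod m})"
      by simp
    also have "\<dots> \<le> real (N + m)"
      using card_residue_class_interval[OF assms, of M N "n mod m"] of_nat_le_iff by blast
    finally show ?thesis by simp
  qed
  have "complex_of_real (\<Sum>b=1..m. (cmod (\<Sum>n\<in>?I. a n * e n ^ b))\<^sup>2)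
      = (\<Sum>b=1..m. \<Sum>n\<in>?I. \<Sum>k\<in>?I. a n * cnj (a k) * (e n ^ b * cnj (e k ^ b)))"
    by (simp add: complex_norm_square sum_product mult_ac flip: of_real_power)
  also have "\<dots> = (\<Sum>n\<in>?I. \<Sum>k\<in>?I. \<Sum>b=1..m. a n * cnj (a k) * (e n ^ b * cnj (e k ^ b)))"
    by (subst sum.swap, rule sum.cong[OF refl], subst sum.swap, rule refl)
  also have "\<dots> = (\<Sum>n\<in>?I. \<Sum>k\<in>?I. a n * cnj (a k) * of_real (\<delta> n k))"
    by (simp only: sum_distrib_left [symmetric] orth)
  finally have expand: "complex_of_real (\<Sum>b=1..m. (cmod (\<Sum>n\<in>?I. a n * e n ^ b))\<^sup>2) = \<dots>" .
  have "(\<Sum>b=1..m. (cmod (\<Sum>n\<in>?I. a n * e n ^ b))\<^sup>2)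
      = cmod (complex_of_real (\<Sum>b=1..m. (cmod (\<Sum>n\<in>?I. a n * e n ^ b))\<^sup>2))"
    by (simp only: norm_of_real abs_of_nonneg sum_nonneg zero_le_power2)
  also have "\<dots> \<le> (\<Sum>n\<in>?I. \<Sum>k\<in>?I. cmod (a n) * cmod (a k) * \<delta> n k)"
    unfolding expand using nonneg
    by (intro sum_norm_le) (simp add: norm_mult)
  also have "\<dots> \<le> (\<Sum>n\<in>?I. \<Sum>k\<in>?I. ((cmod (a n))\<^sup>2 * \<delta> n k + (cmod (a k))\<^sup>2 * \<delta> n k) / 2)"
  proof (intro sum_mono)
    fix n k
    have "cmod (a n) * cmod (a k) \<le> ((cmod (a n))\<^sup>2 + (cmod (a k))\<^sup>2) / 2"
      using sum_squares_bound[of "cmod (a n)" "cmod (a k)"] by simp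
    from mult_right_mono[OF this nonneg[of n k]]
    show "cmod (a n) * cmod (a k) * \<delta> n k
        \<le> ((cmod (a n))\<^sup>2 * \<delta> n k + (cmod (a k))\<^sup>2 * \<delta> n k) / 2"
      by (simp add: algebra_simps)
  qed
  also have "\<dots> = ((\<Sum>n\<in>?I. \<Sum>k\<in>?I. (cmod (a n))\<^sup>2 * \<delta> n k)
                  + (\<Sum>n\<in>?I. \<Sum>k\<in>?I. (cmod (a k))\<^sup>2 * \<delta> n k)) / 2"
    by (simp only: sum.distrib sum_divide_distrib [symmetric])
  also have "(\<Sum>n\<in>?I. \<Sum>k\<in>?I. (cmod (a k))\<^sup>2 * \<delta> n k) = (\<Sum>n\<in>?I. \<Sum>k\<in>?I. (cmod (a n))\<^sup>2 * \<delta> n k)"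
    by (subst sum.swap) (simp only: sym)
  also have "((\<Sum>n\<in>?I. \<Sum>k\<in>?I. (cmod (a n))\<^sup>2 * \<delta> n k)
              + (\<Sum>n\<in>?I. \<Sum>k\<in>?I. (cmod (a n))\<^sup>2 * \<delta> n k)) / 2
      = (\<Sum>n\<in>?I. (cmod (a n))\<^sup>2 * (\<Sum>k\<in>?I. \<delta> n k))"
    by (simp only: sum_distrib_left field_sum_of_halves add_divide_distrib)
  also have "\<dots> \<le> (\<Sum>n\<in>?I. (cmod (a n))\<^sup>2 * (real N + real m))"
    by (intro sum_mono mult_left_mono row) simp
  also have "\<dots> = (real N + real m) * (\<Sum>n\<in>?I. (cmod (a n))\<^sup>2)"
    by (simp add: sum_distrib_left mult.commute)
  finally show ?thesis
    by (simp only: exp_eq)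
qed

lemma poly_le_sum_abs_coeffs:
  fixes f :: "'a::linordered_idom poly"
  assumes "x \<ge> 1"
  shows "poly f x \<le> (\<Sum>i\<le>degree f. \<bar>coeff f i\<bar>) * x ^ degree f"
proof -
  have "poly f x = (\<Sum>i\<le>degree f. coeff f i * x ^ i)"
    by (rule poly_altdef)
  also have "\<dots> \<le> (\<Sum>i\<le>degree f. \<bar>coeff f i\<bar> * x ^ degree f)"
    using assms by (intro sum_mono mult_mono power_increasing) auto
  finally show ?thesis
    by (simp add: sum_distrib_right)
qed

text \<open>
  The exponent of \<open>Q\<close> is written as \<open>t / 2 + s\<close>: the part \<open>t / 2\<close> pays for the missing \<open>N\<^sup>1\<^sup>/\<^sup>4\<close>,
  and any \<open>s \<ge> 1\<close> pays for the factor \<open>Q\<close>.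
\<close>
lemma mult_le_powr_three_quarters:
  fixes N Q t s :: real
  assumes "N > 0" "Q \<ge> 1" "N \<le> Q powr (2 * t)" "s \<ge> 1"
  shows "N * Q \<le> N powr (3/4) * Q powr (t / 2 + s)"
proof -
  have "N powr (1/4) \<le> (Q powr (2 * t)) powr (1/4)"
    using assms by (intro powr_mono2) auto
  then have quarter: "N powr (1/4) \<le> Q powr (t / 2)"
    by (simp add: powr_powr)
  have linear: "Q \<le> Q powr s"
    using powr_mono[of 1 s Q] assms by simp
  have "N powr (3/4) * N powr (1/4) = N"
    using assms by (simp flip: powr_add)
  then have "N * Q = N powr (3/4) * (N powr (1/4) * Q)"
    by (simp flip: mult.assoc)
  also have "\<dots> \<le> N powr (3/4) * (Q powr (t / 2) * Q powr s)"
    using assms by (intro mult_left_mono mult_mono quarter linear) auto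
  finally show ?thesis
    by (simp add: powr_add)
qed

theorem corollary1p4:
  fixes f :: "int poly" and \<epsilon> :: real
  assumes "\<epsilon> > 0" and "degree f \<ge> 3"
  shows "\<exists>C>0. \<forall>(a :: nat \<Rightarrow> complex) (M :: nat) (Q :: nat) (N :: nat).
    Q > 0 \<longrightarrow> N > 0 \<longrightarrow> Q ^ degree f \<le> N \<longrightarrow> N \<le> Q ^ (2 * degree f) \<longrightarrow>
    (\<Sum>q=1..Q. \<Sum>b\<in>{b::int. 1 \<le> b \<and> b \<le> poly f (int q) \<and> gcd b (poly f (int q)) = 1}.
       (cmod (\<Sum>n=M+1..M+N. a n *
          exp (2 * complex_of_real pi * \<i> * of_int b * of_nat n / of_int (poly f (int q)))))\<^sup>2)
    \<le> C * (real N * real Q powr (1/2)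
          + real N powr (3/4)
            * real Q powr (real (degree f) / 2 + 2 - 1 / (50 * real (degree f))))
        * real Q powr \<epsilon> * (\<Sum>n=M+1..M+N. (cmod (a n))\<^sup>2)"
proof -
  define d where "d = degree f"
  define B where "B = (\<Sum>i\<le>degree f. \<bar>coeff f i\<bar>)"
  have B_nonneg: "B \<ge> 0"
    by (simp add: B_def sum_nonneg)
  have bound:
    "(\<Sum>q=1..Q. \<Sum>b\<in>{b::int. 1 \<le> b \<and> b \<le> poly f (int q) \<and> gcd b (poly f (int q)) = 1}.
       (cmod (\<Sum>n=M+1..M+N. a n *
          exp (2 * complex_of_real pi * \<i> * of_int b * of_nat n / of_int (poly f (int q)))))\<^sup>2)
    \<le> (1 + of_int B) * (real N * real Q powr (1/2)
          + real N powr (3/4) * real Q powr (real d / 2 + 2 - 1 / (50 * real d)))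
        * real Q powr \<epsilon> * (\<Sum>n=M+1..M+N. (cmod (a n))\<^sup>2)"
    if "Q > 0" "N > 0" "Q ^ d \<le> N" "N \<le> Q ^ (2 * d)"
    for a :: "nat \<Rightarrow> complex" and M Q N :: nat
  proof -
    define S where "S = (\<Sum>n=M+1..M+N. (cmod (a n))\<^sup>2)"
    have S_nonneg: "S \<ge> 0"
      by (simp add: S_def sum_nonneg)
    have single: "(\<Sum>b\<in>{b::int. 1 \<le> b \<and> b \<le> poly f (int q) \<and> gcd b (poly f (int q)) = 1}.
        (cmod (\<Sum>n=M+1..M+N. a n *
          exp (2 * complex_of_real pi * \<i> * of_int b * of_nat n / of_int (poly f (int q)))))\<^sup>2)
      \<le> (1 + of_int B) * real N * S" (is "(\<Sum>b\<in>?R. ?F b) \<le> _") if q: "q \<in> {1..Q}" for q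
    proof (cases "poly f (int q) > 0")
      case False
      then have "?R = {}" by auto
      then show ?thesis
        using B_nonneg S_nonneg by (simp only: sum.empty) simp
    next
      case True
      define m where "m = nat (poly f (int q))"
      have m: "m > 0" "poly f (int q) = int m"
        using True by (auto simp: m_def)
      have "int m \<le> B * int q ^ d"
        using poly_le_sum_abs_coeffs[of "int q" f] q m by (simp add: B_def d_def)
      also have "\<dots> \<le> B * int N"
      proof (rule mult_left_mono[OF _ B_nonneg])
        have "q ^ d \<le> N"
          using q \<open>Q ^ d \<le> N\<close> by (meson atLeastAtMost_iff le_trans power_mono zero_le)
        then show "int q ^ d \<le> int N"
          by (simp flip: of_nat_power)
      qed
      finally have "real_of_int (int m) \<le> real_of_int (B * int N)"
        by (simp only: of_int_le_iff)
      then have m_le: "real m \<le> of_int B * real N"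
        by simp
      have "sum ?F ?R \<le> sum ?F (int ` {1..m})"
      proof (rule sum_mono2)
        show "?R \<subseteq> int ` {1..m}"
          by (auto simp: image_int_atLeastAtMost m)
      qed auto
      also have "\<dots> = (\<Sum>b=1..m. (cmod (\<Sum>n=M+1..M+N. a n *
            exp (2 * of_real pi * \<i> * of_nat b * of_nat n / of_nat m)))\<^sup>2)"
        by (subst sum.reindex) (auto simp: m)
      also have "\<dots> \<le> (real N + real m) * S"
        unfolding S_def by (rule additive_large_sieve_single_modulus[OF m(1)])
      also have "\<dots> \<le> (1 + of_int B) * real N * S"
        using m_le S_nonneg by (intro mult_right_mono) (auto simp: algebra_simps)
      finally show ?thesis .
    qed
    have QN: "real N * real Q \<le> (real N * real Q powr (1/2)
        + real N powr (3/4) * real Q powr (real d / 2 + 2 - 1 / (50 * real d))) * real Q powr \<epsilon>"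
    proof -
      have Q1: "real Q \<ge> 1" using \<open>Q > 0\<close> by simp
      have "1 / (50 * real d) \<le> 1"
        using assms(2) by (simp add: d_def)
      moreover have "real N \<le> real Q powr (2 * real d)"
        using \<open>N \<le> Q ^ (2 * d)\<close> \<open>Q > 0\<close> powr_realpow[of "real Q" "2 * d"]
        by (simp flip: of_nat_power)
      ultimately have "real N * real Q
          \<le> real N powr (3/4) * real Q powr (real d / 2 + (2 - 1 / (50 * real d)))"
        using Q1 \<open>N > 0\<close> by (intro mult_le_powr_three_quarters) auto
      also have "\<dots> \<le> (real N * real Q powr (1/2)
          + real N powr (3/4) * real Q powr (real d / 2 + 2 - 1 / (50 * real d))) * 1"
        by (simp add: algebra_simps)
      also have "\<dots> \<le> (real N * real Q powr (1/2)
          + real N powr (3/4) * real Q powr (real d / 2 + 2 - 1 / (50 * real d))) * real Q powr \<epsilon>"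
        using Q1 assms(1) by (intro mult_left_mono ge_one_powr_ge_zero) auto
      finally show ?thesis .
    qed
    have "(\<Sum>q=1..Q. \<Sum>b\<in>{b::int. 1 \<le> b \<and> b \<le> poly f (int q) \<and> gcd b (poly f (int q)) = 1}.
        (cmod (\<Sum>n=M+1..M+N. a n *
          exp (2 * complex_of_real pi * \<i> * of_int b * of_nat n / of_int (poly f (int q)))))\<^sup>2)
      \<le> (\<Sum>q=1..Q. (1 + of_int B) * real N * S)"
      by (intro sum_mono single)
    also have "\<dots> = (1 + of_int B) * (real N * real Q) * S"
      by simp
    also have "\<dots> \<le> (1 + of_int B) * ((real N * real Q powr (1/2)
        + real N powr (3/4) * real Q powr (real d / 2 + 2 - 1 / (50 * real d))) * real Q powr \<epsilon>) * S"
      using B_nonneg S_nonneg QN by (intro mult_right_mono mult_left_mono) auto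
    finally show ?thesis
      by (simp only: S_def mult.assoc)
  qed
  have "(0::real) < 1 + of_int B"
    using B_nonneg by simp
  with bound show ?thesis
    unfolding d_def by blast
qed

end
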